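(* Let $X = D\cup S$ be a p-consistent set of defeasible sentences ($D$) and strict sentences ($S$), and let $\phi,\psi\in\mathcal{F}$. Then $X$ strictly p-entails $\phi\Rightarrow\psi$ if and only if there exists a subset $S'$ of $S$ such that $S\cup\{True\rightarrow\phi\}$ is p-consistent and $\phi\Rightarrow\neg\psi$ is not tolerated by $S'$.
   Context: $\mathcal{F}$ is the set of propositional formulas over a fixed finite set of propositional variables; $True$ denotes a tautology. A defeasible sentence is an expression $\phi \rightarrow \psi$ and a strict sentence is an expression $\phi \Rightarrow \psi$, with $\phi,\psi \in \mathcal{F}$ (the two kinds are formally distinct). A conditional sentence is a sentence of either kind, with antecedent $\phi$ and consequent $\psi$. Probability assignments: a truth assignment $t$ maps formulas to $\{0,1\}$ respecting the boolean connectives. Let $P$ be a probability distribution on the (finite) set of truth assignments. For a conditional sentence $x$ (defeasible or strict) with antecedent $\phi$ and consequent $\psi$, $$P(x) = \frac{\sum_t P(t)\, t(\phi\wedge\psi)}{\sum_t P(t)\, t(\phi)}.$$ $P$ is proper for a sentence if this denominator is non-zero, and proper for a set of sentences if it is proper for each of them. For a set $X=D\cup S$ and $\varepsilon>0$, $\mathcal{P}_{X,\varepsilon}$ is the set of distributions $P$ proper for $X$ with $P(d)\ge 1-\varepsilon$ for all $d\in D$ and $P(s)=1$ for all $s\in S$. p-consistency: $X$ is p-consistent if $\mathcal{P}_{X,\varepsilon}\neq\emptyset$ for every $\varepsilon>0$. Tolerance: a conditional sentence $x$ with antecedent $\alpha$ and consequent $\beta$ is tolerated by a set $Y$ of conditional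 sentences if some truth assignment $t$ has $t(\alpha)=t(\beta)=1$ and falsifies no sentence of $Y$ (a sentence with antecedent $\gamma$ and consequent $\eta$ is falsified by $t$ if $t(\gamma)=1$ and $t(\eta)=0$). Strict p-entailment: a p-consistent set $X$ strictly p-entails a strict sentence $s'$ if (1) for every $\varepsilon>0$ there is a $P\in\mathcal{P}_{X,\varepsilon}$ that is proper for $s'$; and (2) for every $\varepsilon>0$, every $P\in\mathcal{P}_{X,\varepsilon}$ that is proper for $s'$ satisfies $P(s')=1$. *)

theory Defs
  imports "HOL-Probability.Probability_Mass_Function"
begin

text \<open>
  Propositional formulas; the finitely many propositional variables are the elements of a
  finite type \<open>'v\<close>.
\<close>

datatype 'v form =
    Var 'v
  | Top
  | Neg "'v form"
  | Conj "'v form" "'v form"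
  | Disj "'v form" "'v form"
  | Impl "'v form" "'v form"

text \<open>
  A truth assignment on formulas that respects the connectives is determined by its values on the
  variables, so truth assignments are represented by valuations \<open>'v \<Rightarrow> bool\<close>, and
  \<open>holds t \<phi>\<close> says that \<open>t\<close> gives \<open>\<phi>\<close> the value 1.
\<close>

primrec holds :: "('v \<Rightarrow> bool) \<Rightarrow> 'v form \<Rightarrow> bool" where
  "holds t (Var p) \<longleftrightarrow> t p"
| "holds t Top \<longleftrightarrow> True"
| "holds t (Neg \<phi>) \<longleftrightarrow> \<not> holds t \<phi>"
| "holds t (Conj \<phi> \<psi>) \<longleftrightarrow> holds t \<phi> \<and> holds t \<psi>"
| "holds t (Disj \<phi> \<psi>) \<longleftrightarrow> holds t \<phi> \<or> holds t \<psi>"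
| "holds t (Impl \<phi> \<psi>) \<longleftrightarrow> (holds t \<phi> \<longrightarrow> holds t \<psi>)"

datatype 'v sentence =
    is_Defeasible: Defeasible (ante: "'v form") (conseq: "'v form")
  | is_Strict: Strict (ante: "'v form") (conseq: "'v form")

definition form_prob :: "('v::finite \<Rightarrow> bool) pmf \<Rightarrow> 'v form \<Rightarrow> real" where
  "form_prob P \<phi> = (\<Sum>t\<in>UNIV. pmf P t * of_bool (holds t \<phi>))"

definition sentence_prob :: "('v::finite \<Rightarrow> bool) pmf \<Rightarrow> 'v sentence \<Rightarrow> real" where
  "sentence_prob P x = form_prob P (Conj (ante x) (conseq x)) / form_prob P (ante x)"

definition proper :: "('v::finite \<Rightarrow> bool) pmf \<Rightarrow> 'v sentence \<Rightarrow> bool" where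
  "proper P x \<longleftrightarrow> form_prob P (ante x) \<noteq> 0"

text \<open>
  The two kinds of sentences are distinct constructors, so the decomposition \<open>X = D \<union> S\<close> can be
  read off from \<open>X\<close> itself.
\<close>

definition admissible :: "'v::finite sentence set \<Rightarrow> real \<Rightarrow> ('v \<Rightarrow> bool) pmf set" where
  "admissible X \<epsilon> = {P. (\<forall>x\<in>X. proper P x) \<and>
     (\<forall>d\<in>X. is_Defeasible d \<longrightarrow> sentence_prob P d \<ge> 1 - \<epsilon>) \<and>
     (\<forall>s\<in>X. is_Strict s \<longrightarrow> sentence_prob P s = 1)}"

definition p_consistent :: "'v::finite sentence set \<Rightarrow> bool" where
  "p_consistent X \<longleftrightarrow> (\<forall>\<epsilon>>0. admissible X \<epsilon> \<noteq> {})"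

definition falsifies :: "('v \<Rightarrow> bool) \<Rightarrow> 'v sentence \<Rightarrow> bool" where
  "falsifies t x \<longleftrightarrow> holds t (ante x) \<and> \<not> holds t (conseq x)"

definition tolerated_by :: "'v sentence \<Rightarrow> 'v sentence set \<Rightarrow> bool" where
  "tolerated_by x Y \<longleftrightarrow>
     (\<exists>t. holds t (ante x) \<and> holds t (conseq x) \<and> (\<forall>y\<in>Y. \<not> falsifies t y))"

text \<open>
  Only meant for p-consistent \<open>X\<close> and strict \<open>s\<close>.
\<close>

definition strictly_p_entails :: "'v::finite sentence set \<Rightarrow> 'v sentence \<Rightarrow> bool" where
  "strictly_p_entails X s \<longleftrightarrow>
     (\<forall>\<epsilon>>0. \<exists>P\<in>admissible X \<epsilon>. proper P s) \<and>
     (\<forall>\<epsilon>>0. \<forall>P\<in>admissible X \<epsilon>. proper P s \<longrightarrow> sentence_prob P s = 1)"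

end

theory Submission
  imports Defs
begin

text \<open>
  A distribution gives every strict sentence of \<open>X\<close> probability 1 iff no assignment in its support
  falsifies one. So if \<open>t\<close> falsifies no strict sentence, moving a small enough amount of mass of an
  admissible distribution to \<open>t\<close> preserves admissibility up to an arbitrarily small loss in
  \<open>\<epsilon>\<close>; the assignments that can occur in supports of admissible distributions are therefore
  exactly those compatible with the strict sentences. Both sides of the equivalence say that some
  such assignment satisfies \<open>\<phi>\<close> and that all of them which do satisfy \<open>\<psi>\<close>.
\<close>

lemma form_prob_nonneg: "form_prob P \<phi> \<ge> 0"
  unfolding form_prob_def by (intro sum_nonneg) simp

lemma form_prob_le_1: "form_prob P \<phi> \<le> 1"
proof -
  have "form_prob P \<phi> \<le> (\<Sum>t\<in>UNIV. pmf P t)"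
    unfolding form_prob_def by (intro sum_mono) (simp add: mult_left_le)
  also have "\<dots> = 1" by (simp add: sum_pmf_eq_1)
  finally show ?thesis .
qed

lemma form_prob_Top: "form_prob P Top = 1"
  unfolding form_prob_def by (simp add: sum_pmf_eq_1)

lemma form_prob_ge_pmf: "holds t \<phi> \<Longrightarrow> pmf P t \<le> form_prob P \<phi>"
  unfolding form_prob_def
  using member_le_sum[of t UNIV "\<lambda>t. pmf P t * of_bool (holds t \<phi>)"] by simp

lemma form_prob_eq_0_iff: "form_prob P \<phi> = 0 \<longleftrightarrow> (\<forall>t\<in>set_pmf P. \<not> holds t \<phi>)"
  unfolding form_prob_def
  by (subst sum_nonneg_eq_0_iff) (auto simp: set_pmf_iff)

lemma form_prob_split:
  "form_prob P \<alpha> = form_prob P (Conj \<alpha> \<beta>) + form_prob P (Conj \<alpha> (Neg \<beta>))"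
  unfolding form_prob_def sum.distrib[symmetric] by (intro sum.cong) auto

lemma proper_iff: "proper P x \<longleftrightarrow> (\<exists>t\<in>set_pmf P. holds t (ante x))"
  unfolding proper_def form_prob_eq_0_iff by simp

text \<open>The antecedent's mass splits into a verifying and a falsifying part; the quotient is 1
  exactly when the falsifying part has mass 0.\<close>

lemma sentence_prob_eq_1_iff:
  assumes "proper P x"
  shows "sentence_prob P x = 1 \<longleftrightarrow> (\<forall>t\<in>set_pmf P. \<not> falsifies t x)"
proof -
  have "sentence_prob P x = 1 \<longleftrightarrow> form_prob P (Conj (ante x) (Neg (conseq x))) = 0"
    using assms form_prob_split[of P "ante x" "conseq x"]
    by (auto simp: sentence_prob_def proper_def)
  then show ?thesis by (auto simp: form_prob_eq_0_iff falsifies_def)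
qed

lemma sentence_prob_ge_iff:
  assumes "proper P x"
  shows "sentence_prob P x \<ge> c \<longleftrightarrow> c * form_prob P (ante x) \<le> form_prob P (Conj (ante x) (conseq x))"
  using assms form_prob_nonneg[of P "ante x"]
  by (simp add: sentence_prob_def proper_def pos_le_divide_eq)

text \<open>Properness makes the denominators positive, so they can be cleared: the defeasible
  bounds become linear in \<open>P\<close>, and the strict conditions depend on the support alone.
  Both forms suit mixtures.\<close>

lemma admissible_iff:
  "P \<in> admissible X \<epsilon> \<longleftrightarrow> (\<forall>x\<in>X. proper P x) \<and>
     (\<forall>d\<in>X. is_Defeasible d \<longrightarrow>
        (1 - \<epsilon>) * form_prob P (ante d) \<le> form_prob P (Conj (ante d) (conseq d))) \<and>
     (\<forall>s\<in>X. is_Strict s \<longrightarrow> (\<forall>t\<in>set_pmf P. \<not> falsifies t s))"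
  unfolding admissible_def
  by (auto simp: sentence_prob_eq_1_iff sentence_prob_ge_iff)

lemma admissible_mono: "X \<subseteq> Y \<Longrightarrow> admissible Y \<epsilon> \<subseteq> admissible X \<epsilon>"
  unfolding admissible_def by auto

text \<open>The convex combination giving weight \<delta> to \<open>Q\<close>, realised by a biased
  coin so that it is a distribution by construction.\<close>

definition mix_pmf :: "real \<Rightarrow> 'a pmf \<Rightarrow> 'a pmf \<Rightarrow> 'a pmf" where
  "mix_pmf \<delta> P Q = bind_pmf (bernoulli_pmf \<delta>) (\<lambda>b. if b then Q else P)"

lemma pmf_mix_pmf:
  assumes "0 \<le> \<delta>" "\<delta> \<le> 1"
  shows "pmf (mix_pmf \<delta> P Q) t = (1 - \<delta>) * pmf P t + \<delta> * pmf Q t"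
  using assms unfolding mix_pmf_def pmf_bind by simp

lemma set_mix_pmf:
  assumes "0 < \<delta>" "\<delta> < 1"
  shows "set_pmf (mix_pmf \<delta> P Q) = set_pmf P \<union> set_pmf Q"
  using assms by (simp add: mix_pmf_def set_pmf_bernoulli UNIV_bool Un_commute)

lemma form_prob_mix_pmf:
  assumes "0 \<le> \<delta>" "\<delta> \<le> 1"
  shows "form_prob (mix_pmf \<delta> P Q) \<phi> = (1 - \<delta>) * form_prob P \<phi> + \<delta> * form_prob Q \<phi>"
  unfolding form_prob_def pmf_mix_pmf[OF assms]
  unfolding sum_distrib_left sum.distrib[symmetric]
  by (intro sum.cong) (auto simp: algebra_simps)

lemma admissible_add_assignment:
  assumes P: "P \<in> admissible X \<epsilon>" and "\<epsilon> < \<epsilon>'" "0 < \<epsilon>'"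
    and t: "\<And>s. s \<in> X \<Longrightarrow> is_Strict s \<Longrightarrow> \<not> falsifies t s"
  obtains P' where "P' \<in> admissible X \<epsilon>'" "t \<in> set_pmf P'"
proof -
  \<comment> \<open>The least positive mass bounds all antecedent probabilities from below at once,
    since each antecedent holds somewhere in the support; this is uniform even when \<open>X\<close>
    is infinite.\<close>
  define m where "m = Min (pmf P ` set_pmf P)"
  have m_le: "m \<le> form_prob P (ante x)" if x: "x \<in> X" for x
  proof -
    obtain u where u: "u \<in> set_pmf P" "holds u (ante x)"
      using P x by (auto simp: admissible_iff proper_iff)
    have "m \<le> pmf P u" unfolding m_def using u by (intro Min_le) auto
    then show ?thesis using form_prob_ge_pmf[OF u(2), of P] by linarith
  qed
  have m_pos: "m > 0"
    unfolding m_def by (subst Min_gr_iff) (auto simp: set_pmf_not_empty pmf_positive)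
  \<comment> \<open>Relaxing \<epsilon> to \<epsilon>' gives each defeasible sentence slack at least
    \<open>k\<close> under \<open>P\<close>. The weight \<delta> solves
    \<open>\<delta> = (1 - \<delta>) * k\<close>, so the mass given to \<open>t\<close> costs no
    more than the scaled slack.\<close>
  define k where "k = (\<epsilon>' - \<epsilon>) * m"
  define \<delta> where "\<delta> = k / (1 + k)"
  have k: "k > 0" using m_pos assms by (simp add: k_def)
  have \<delta>: "0 < \<delta>" "\<delta> < 1"
    using k by (simp_all add: \<delta>_def)
  have "1 - \<delta> = 1 / (1 + k)"
    using k by (simp add: \<delta>_def divide_simps)
  then have \<delta>_eq: "\<delta> = (1 - \<delta>) * k"
    by (simp add: \<delta>_def)
  define P' where "P' = mix_pmf \<delta> P (return_pmf t)"
  have set: "set_pmf P' = insert t (set_pmf P)"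
    by (simp add: P'_def set_mix_pmf \<delta>)
  have D: "(1 - \<epsilon>') * form_prob P' (ante d) \<le> form_prob P' (Conj (ante d) (conseq d))"
    if d: "d \<in> X" "is_Defeasible d" for d
  proof -
    define A where "A = form_prob P (ante d)"
    define B where "B = form_prob P (Conj (ante d) (conseq d))"
    define a where "a = form_prob (return_pmf t) (ante d)"
    define b where "b = form_prob (return_pmf t) (Conj (ante d) (conseq d))"
    have AB: "(1 - \<epsilon>) * A \<le> B"
      using P d by (auto simp: admissible_iff A_def B_def)
    have "m \<le> A" using m_le[OF d(1)] by (simp add: A_def)
    have "0 \<le> a" "a \<le> 1" "0 \<le> b"
      by (simp_all add: a_def b_def form_prob_nonneg form_prob_le_1)
    have "(1 - \<epsilon>') * a \<le> 1"
      using mult_right_mono[of "1 - \<epsilon>'" 1 a] \<open>0 \<le> a\<close> \<open>a \<le> 1\<close> \<open>0 < \<epsilon>'\<close> by linarith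
    then have "\<delta> * ((1 - \<epsilon>') * a) \<le> \<delta> * 1"
      using \<delta> by (intro mult_left_mono) auto
    also have "\<delta> * 1 \<le> (1 - \<delta>) * ((\<epsilon>' - \<epsilon>) * A)"
    proof -
      have "(1 - \<delta>) * k \<le> (1 - \<delta>) * ((\<epsilon>' - \<epsilon>) * A)"
        unfolding k_def using \<delta> \<open>m \<le> A\<close> \<open>\<epsilon> < \<epsilon>'\<close> by (intro mult_left_mono) auto
      then show ?thesis using \<delta>_eq by simp
    qed
    finally have 1: "\<delta> * ((1 - \<epsilon>') * a) \<le> (1 - \<delta>) * ((\<epsilon>' - \<epsilon>) * A)" .
    have 2: "(1 - \<delta>) * ((1 - \<epsilon>) * A) \<le> (1 - \<delta>) * B"
      using AB \<delta> by (intro mult_left_mono) auto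
    \<comment> \<open>Write \<open>(1 - \<epsilon>') * A\<close> as
      \<open>(1 - \<epsilon>) * A - (\<epsilon>' - \<epsilon>) * A\<close> and add facts 1 and 2.
      The worst case is a \<open>t\<close> that falsifies \<open>d\<close>, where
      \<open>b = 0\<close>.\<close>
    have "(1 - \<epsilon>') * ((1 - \<delta>) * A + \<delta> * a) \<le> (1 - \<delta>) * B"
      using 1 2 by (simp add: algebra_simps)
    also have "\<dots> \<le> (1 - \<delta>) * B + \<delta> * b" using \<delta> \<open>0 \<le> b\<close> by simp
    finally show ?thesis
      using \<delta> by (simp add: P'_def form_prob_mix_pmf A_def B_def a_def b_def)
  qed
  have "P' \<in> admissible X \<epsilon>'"
    using P D t by (auto simp: admissible_iff proper_iff set)
  then show thesis using that set by blast
qed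

text \<open>The sentence with antecedent \<open>Top\<close> just demands that \<phi> have
  probability at least \<open>1 - \<epsilon>\<close>. With only strict sentences besides it, nearly
  all mass may sit on a single compatible assignment.\<close>

lemma p_consistent_insert_Top_iff:
  assumes "\<forall>s\<in>S. is_Strict s" and cons: "p_consistent S"
  shows "p_consistent (S \<union> {Defeasible Top \<phi>}) \<longleftrightarrow>
    (\<exists>t. holds t \<phi> \<and> (\<forall>s\<in>S. \<not> falsifies t s))"
proof
  assume "p_consistent (S \<union> {Defeasible Top \<phi>})"
  \<comment> \<open>Any \<epsilon> below 1 would force \<phi> to have positive probability.\<close>
  then have "admissible (S \<union> {Defeasible Top \<phi>}) (1 / 2) \<noteq> {}"
    unfolding p_consistent_def by simp
  then obtain Q where Q: "Q \<in> admissible (S \<union> {Defeasible Top \<phi>}) (1 / 2)" by blast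
  then have "form_prob Q (Conj Top \<phi>) \<noteq> 0"
    by (auto simp: admissible_iff form_prob_Top)
  then obtain t where "t \<in> set_pmf Q" "holds t \<phi>"
    by (auto simp: form_prob_eq_0_iff)
  then show "\<exists>t. holds t \<phi> \<and> (\<forall>s\<in>S. \<not> falsifies t s)"
    using Q assms(1) by (auto simp: admissible_iff)
next
  assume "\<exists>t. holds t \<phi> \<and> (\<forall>s\<in>S. \<not> falsifies t s)"
  then obtain t where t: "holds t \<phi>" "\<forall>s\<in>S. \<not> falsifies t s" by blast
  show "p_consistent (S \<union> {Defeasible Top \<phi>})"
    unfolding p_consistent_def
  proof (intro allI impI)
    fix \<epsilon> :: real assume "\<epsilon> > 0"
    obtain P where P: "P \<in> admissible S \<epsilon>"
      using cons \<open>\<epsilon> > 0\<close> unfolding p_consistent_def by blast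
    \<comment> \<open>The cap keeps \<delta> below 1 for large \<epsilon>, so that \<open>t\<close>
      stays in the support.\<close>
    define \<delta> where "\<delta> = min \<epsilon> (1 / 2)"
    have \<delta>: "0 < \<delta>" "\<delta> < 1" "\<delta> \<le> \<epsilon>" using \<open>\<epsilon> > 0\<close> by (auto simp: \<delta>_def)
    \<comment> \<open>Here \<open>t\<close> carries the bulk, and \<open>P\<close> keeps weight
      \<delta> only to make the antecedents in \<open>S\<close> proper.\<close>
    define Q where "Q = mix_pmf \<delta> (return_pmf t) P"
    have set: "set_pmf Q = insert t (set_pmf P)"
      by (simp add: Q_def set_mix_pmf \<delta>)
    have "1 \<le> form_prob (return_pmf t) (Conj Top \<phi>)"
      using form_prob_ge_pmf[of t "Conj Top \<phi>" "return_pmf t"] t by simp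
    then have "(1 - \<delta>) * 1 \<le> (1 - \<delta>) * form_prob (return_pmf t) (Conj Top \<phi>)"
      using \<delta> by (intro mult_left_mono) auto
    moreover have "0 \<le> \<delta> * form_prob P (Conj Top \<phi>)"
      using \<delta> by (simp add: form_prob_nonneg)
    ultimately have "1 - \<epsilon> \<le> form_prob Q (Conj Top \<phi>)"
      using \<delta> form_prob_mix_pmf[of \<delta> "return_pmf t" P "Conj Top \<phi>"]
      unfolding Q_def mult_1_right by linarith
    then have "Q \<in> admissible (S \<union> {Defeasible Top \<phi>}) \<epsilon>"
      using P t assms(1)
      by (auto simp: admissible_iff proper_iff set form_prob_Top sentence.distinct_disc)
    then show "admissible (S \<union> {Defeasible Top \<phi>}) \<epsilon> \<noteq> {}" by blast
  qed
qed

text \<open>For every positive \<epsilon>, the assignments satisfying \<phi> in supports of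
  admissible distributions are the same: those falsifying no strict sentence. The two clauses of
  entailment thus become an existence and a universal claim about them.\<close>

lemma strictly_p_entails_Strict_iff:
  assumes cons: "p_consistent X"
  shows "strictly_p_entails X (Strict \<phi> \<psi>) \<longleftrightarrow>
    (\<exists>t. holds t \<phi> \<and> (\<forall>s\<in>X. is_Strict s \<longrightarrow> \<not> falsifies t s)) \<and>
    (\<forall>t. holds t \<phi> \<and> (\<forall>s\<in>X. is_Strict s \<longrightarrow> \<not> falsifies t s) \<longrightarrow> holds t \<psi>)"
    (is "_ \<longleftrightarrow> (\<exists>t. ?C t) \<and> (\<forall>t. ?C t \<longrightarrow> _)")
proof -
  have attained: "\<exists>P\<in>admissible X \<epsilon>. t \<in> set_pmf P" if C: "?C t" and "\<epsilon> > 0" for t and \<epsilon> :: real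
  proof -
    \<comment> \<open>Starting from half of \<epsilon> leaves room for adding
      \<open>t\<close>.\<close>
    obtain P where P: "P \<in> admissible X (\<epsilon> / 2)"
      using cons \<open>\<epsilon> > 0\<close> unfolding p_consistent_def by (meson ex_in_conv half_gt_zero)
    obtain P' where "P' \<in> admissible X \<epsilon>" "t \<in> set_pmf P'"
      by (rule admissible_add_assignment[OF P, of \<epsilon> t]) (use C \<open>\<epsilon> > 0\<close> in auto)
    then show ?thesis by blast
  qed
  have support: "?C t" if "P \<in> admissible X \<epsilon>" "t \<in> set_pmf P" "holds t \<phi>" for P \<epsilon> t
    using that by (auto simp: admissible_iff)
  have ex: "(\<forall>\<epsilon>>0. \<exists>P\<in>admissible X \<epsilon>. proper P (Strict \<phi> \<psi>)) \<longleftrightarrow> (\<exists>t. ?C t)"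
  proof
    assume "\<forall>\<epsilon>>0. \<exists>P\<in>admissible X \<epsilon>. proper P (Strict \<phi> \<psi>)"
    \<comment> \<open>The support condition does not vary with \<epsilon>, so one value, here 1,
      suffices.\<close>
    then obtain P where "P \<in> admissible X 1" "proper P (Strict \<phi> \<psi>)"
      using zero_less_one by blast
    then show "\<exists>t. ?C t" using support by (auto simp: proper_iff)
  next
    assume "\<exists>t. ?C t"
    then show "\<forall>\<epsilon>>0. \<exists>P\<in>admissible X \<epsilon>. proper P (Strict \<phi> \<psi>)"
      using attained unfolding proper_iff sentence.sel by meson
  qed
  have all: "(\<forall>\<epsilon>>0. \<forall>P\<in>admissible X \<epsilon>. proper P (Strict \<phi> \<psi>) \<longrightarrow>
      sentence_prob P (Strict \<phi> \<psi>) = 1) \<longleftrightarrow> (\<forall>t. ?C t \<longrightarrow> holds t \<psi>)" (is "?L \<longleftrightarrow> ?R")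
  proof
    assume L: ?L
    show ?R
    proof (intro allI impI)
      fix t assume C: "?C t"
      then obtain P where P: "P \<in> admissible X 1" "t \<in> set_pmf P"
        using attained zero_less_one by blast
      then have "proper P (Strict \<phi> \<psi>)" using C by (auto simp: proper_iff)
      moreover from this have "sentence_prob P (Strict \<phi> \<psi>) = 1"
        using L P(1) zero_less_one by blast
      ultimately show "holds t \<psi>"
        using P(2) C by (auto simp: sentence_prob_eq_1_iff falsifies_def)
    qed
  next
    assume ?R
    then show ?L
      using support by (auto simp: sentence_prob_eq_1_iff falsifies_def)
  qed
  show ?thesis unfolding strictly_p_entails_def ex all ..
qed

theorem theorem3:
  fixes D S :: "'v::finite sentence set" and \<phi> \<psi> :: "'v form"
  assumes "\<forall>d\<in>D. is_Defeasible d"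
    and "\<forall>s\<in>S. is_Strict s"
    and "p_consistent (D \<union> S)"
  shows "strictly_p_entails (D \<union> S) (Strict \<phi> \<psi>) \<longleftrightarrow>
    (\<exists>S'\<subseteq>S. p_consistent (S \<union> {Defeasible Top \<phi>}) \<and>
       \<not> tolerated_by (Strict \<phi> (Neg \<psi>)) S')"
proof -
  have strict: "(\<forall>s\<in>D \<union> S. is_Strict s \<longrightarrow> \<not> falsifies t s) \<longleftrightarrow> (\<forall>s\<in>S. \<not> falsifies t s)" for t
    using assms(1,2) sentence.distinct_disc(1) by blast
  have "p_consistent S"
    using assms(3) admissible_mono[of S "D \<union> S"] unfolding p_consistent_def by blast
  note consistent_iff = p_consistent_insert_Top_iff[OF assms(2) this]
  \<comment> \<open>Tolerance is antitone in the set: a witness for \<open>S\<close> also serves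
    \<open>S'\<close>. Hence the existential over subsets collapses to \<open>S\<close>
    itself.\<close>
  have "\<not> tolerated_by (Strict \<phi> (Neg \<psi>)) S" if "S' \<subseteq> S" "\<not> tolerated_by (Strict \<phi> (Neg \<psi>)) S'" for S'
    using that unfolding tolerated_by_def by blast
  then have "(\<exists>S'\<subseteq>S. p_consistent (S \<union> {Defeasible Top \<phi>}) \<and> \<not> tolerated_by (Strict \<phi> (Neg \<psi>)) S') \<longleftrightarrow>
      p_consistent (S \<union> {Defeasible Top \<phi>}) \<and> \<not> tolerated_by (Strict \<phi> (Neg \<psi>)) S"
    by blast
  \<comment> \<open>Not being tolerated by \<open>S\<close> says that every compatible assignment
    satisfying \<phi> satisfies \<psi>, which is the universal half of entailment.\<close>
  then show ?thesis
    unfolding strictly_p_entails_Strict_iff[OF assms(3)] strict consistent_iff tolerated_by_def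
    by auto
qed

end
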